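(* For all integers $m,n\ge 0$, $$H_{n+m,\lambda}^{Y}(t)=\sum_{j=0}^{n}\sum_{k=0}^{m}\binom{m}{k}\frac{t^{j}}{j!}\sum_{\substack{l_{1}+\cdots+l_{j}=n\\ l_1,\dots,l_j\ge 1}}\binom{n}{l_{1},\dots,l_{j}}E\bigg[\langle S_{j}+n\lambda\rangle_{m-k,\lambda}\prod_{i=1}^{j}\langle Y_{i}\rangle_{l_{i},\lambda}\bigg]H_{k,\lambda}^{Y}(t),$$ where for $j=0$ the inner sum over compositions is $1$ if $n=0$ and $0$ if $n>0$.
   Context: Let $Y$ be a real random variable with $E[|Y|^{n}]<\infty$ for all integers $n\ge 0$ and $\lim_{n\to\infty}|t|^{n}E[|Y|^{n}]/n!=0$ for $|t|<r$, for some $r>0$. Let $Y_1,Y_2,\dots$ be i.i.d. copies of $Y$, $S_0=0$ and $S_j=Y_1+\cdots+Y_j$. Fix a nonzero real $\lambda$. Put $\langle x\rangle_{0,\lambda}=1$, $\langle x\rangle_{n,\lambda}=x(x+\lambda)\cdots(x+(n-1)\lambda)$, and $e_\lambda^{-Y}(-s)=(1-\lambda s)^{-Y/\lambda}$, so $E[e_\lambda^{-Y}(-s)]=\sum_{n\ge0}E[\langle Y\rangle_{n,\lambda}]s^n/n!$ near $s=0$. The probabilistic heterogeneous Bell polynomials $H^Y_{n,\lambda}(t)$ are defined by $e^{t(E[e_{\lambda}^{-Y}(-s)]-1)}=\sum_{n\ge0}H_{n,\lambda}^{Y}(t)s^{n}/n!$. $\binom{n}{l_1,\dots,l_j}$ denotes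 the multinomial coefficient.
   Formalization: For j=0, n=0 the inner sum is taken as the single empty composition's term E[⟨S_0⟩_{m-k,λ}]=⟨0⟩_{m-k,λ} (1 if k=m, else 0), not as 1 for every k; the literal value 1 would give the false H_1=H_0+H_1. *)

theory Defs
  imports "HOL-Probability.Probability"
begin

definition rising_fact :: "real \<Rightarrow> real \<Rightarrow> nat \<Rightarrow> real" where
  "rising_fact lam x n = (\<Prod>i<n. x + real i * lam)"

(* The degenerate exponential e_lam^{-y}(-s) for 1 - lam * s > 0, in particular for s near 0. *)
definition deg_exp :: "real \<Rightarrow> real \<Rightarrow> real \<Rightarrow> real" where
  "deg_exp lam y s = (1 - lam * s) powr (- y / lam)"

definition hbell_gf :: "'a measure \<Rightarrow> ('a \<Rightarrow> real) \<Rightarrow> real \<Rightarrow> real \<Rightarrow> real \<Rightarrow> real" where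
  "hbell_gf M Y lam t s = exp (t * (prob_space.expectation M (\<lambda>\<omega>. deg_exp lam (Y \<omega>) s) - 1))"

(* The power series expansion at 0 is unique if it exists, and it exists under the moment
   assumption on Y; without an expansion the value is unspecified. *)
definition hbell :: "'a measure \<Rightarrow> ('a \<Rightarrow> real) \<Rightarrow> real \<Rightarrow> nat \<Rightarrow> real \<Rightarrow> real" where
  "hbell M Y lam n t = fact n * fps_nth (THE F. hbell_gf M Y lam t has_fps_expansion F) n"

(* For j = 0 there is exactly one (empty) composition if n = 0, and none if n > 0. *)
definition compositions :: "nat \<Rightarrow> nat \<Rightarrow> (nat \<Rightarrow> nat) set" where
  "compositions j n = {l \<in> {1..j} \<rightarrow>\<^sub>E {1..}. (\<Sum>i=1..j. l i) = n}"

definition multinomial :: "nat \<Rightarrow> nat \<Rightarrow> (nat \<Rightarrow> nat) \<Rightarrow> real" where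
  "multinomial n j l = fact n / (\<Prod>i=1..j. fact (l i))"

lemma finite_compositions: "finite (compositions j n)"
proof (rule finite_subset)
  show "compositions j n \<subseteq> {1..j} \<rightarrow>\<^sub>E {..n}"
  proof
    fix l assume l: "l \<in> compositions j n"
    have "l i \<le> n" if "i \<in> {1..j}" for i
      using l member_le_sum[of i "{1..j}" l] that by (auto simp: compositions_def)
    with l show "l \<in> {1..j} \<rightarrow>\<^sub>E {..n}"
      by (auto simp: compositions_def PiE_iff)
  qed
qed (auto intro: finite_PiE)

end

theory Submission
  imports Defs "HOL-Complex_Analysis.Laurent_Convergence"
begin

text \<open>
  Let \<open>F\<close> be the exponential generating function of the moments \<open>E \<langle>Y\<rangle>\<^sub>n\<close>. The moment condition
  makes \<open>E exp (u \<bar>Y\<bar>)\<close> finite for small \<open>u\<close>, so the binomial series of \<open>(1 - \<lambda>s) powr (-Y/\<lambda>)\<close> can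
  be integrated termwise, and \<open>n!\<close> times the \<open>n\<close>-th coefficient of \<open>G = exp (t (F - 1))\<close> is the
  \<open>n\<close>-th heterogeneous Bell polynomial. Faa di Bruno's formula writes the \<open>n\<close>-th derivative of
  \<open>G\<close> as \<open>G\<close> times a sum over compositions of products of derivatives of \<open>F\<close>. The coefficients of
  such a product are expectations: \<open>\<langle>Y\<rangle>\<^sub>l\<^sub>+\<^sub>q = \<langle>Y\<rangle>\<^sub>l \<langle>Y + l\<lambda>\<rangle>\<^sub>q\<close>, the generating function of
  \<open>\<langle>x\<rangle>\<^sub>q\<close> is multiplicative in \<open>x\<close>, and the \<open>Y\<^sub>i\<close> are independent. Comparing the \<open>m\<close>-th
  coefficients gives the claim.
\<close>

section \<open>Uniqueness and composition of real power series expansions\<close>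

lemma has_fps_expansion_nth_deriv:
  fixes f :: "real \<Rightarrow> real"
  assumes "f has_fps_expansion F"
  shows "fps_nth F n = (deriv ^^ n) f 0 / fact n"
  using assms
proof (induction n arbitrary: f F)
  case 0
  then have "eval_fps F 0 = f 0"
    unfolding has_fps_expansion_def by (auto dest: eventually_nhds_x_imp_x)
  then show ?case by (simp add: eval_fps_at_0)
next
  case (Suc n)
  have "fps_nth (fps_deriv F) n = (deriv ^^ n) (deriv f) 0 / fact n"
    using Suc.prems by (intro Suc.IH has_fps_expansion_deriv)
  then show ?case
    by (simp add: funpow_Suc_right eq_divide_eq mult_ac del: funpow.simps of_nat_Suc)
qed

text \<open>Each coefficient is recovered from the derivatives of the function at 0, so it does not
  depend on the chosen expansion. This is what resolves the \<open>THE\<close> in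
  \<open>hbell\<close>.\<close>

lemma has_fps_expansion_unique:
  fixes f :: "real \<Rightarrow> real"
  assumes "f has_fps_expansion F" "f has_fps_expansion G"
  shows "F = G"
  by (simp add: fps_eq_iff has_fps_expansion_nth_deriv[OF assms(1)]
      has_fps_expansion_nth_deriv[OF assms(2)])

text \<open>The same coefficients read as complex numbers, so that composition can be settled for
  analytic functions of a complex variable.\<close>

definition fps_complex :: "real fps \<Rightarrow> complex fps" where
  "fps_complex F = Abs_fps (\<lambda>n. of_real (fps_nth F n))"

lemma fps_nth_complex [simp]: "fps_nth (fps_complex F) n = of_real (fps_nth F n)"
  by (simp add: fps_complex_def)

lemma fps_complex_mult: "fps_complex (F * G) = fps_complex F * fps_complex G"
  by (simp add: fps_eq_iff fps_mult_nth)

lemma fps_complex_power: "fps_complex (F ^ n) = fps_complex F ^ n"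
  by (induction n) (simp_all add: fps_complex_mult, simp add: fps_eq_iff)

lemma fps_complex_compose: "fps_complex (F oo G) = fps_complex F oo fps_complex G"
  by (simp add: fps_eq_iff fps_compose_nth fps_complex_power [symmetric])

lemma fps_conv_radius_complex: "fps_conv_radius (fps_complex F) = fps_conv_radius F"
  unfolding fps_conv_radius_def conv_radius_def by simp

lemma eval_fps_complex:
  assumes "ereal \<bar>x\<bar> < fps_conv_radius F"
  shows "eval_fps (fps_complex F) (of_real x) = of_real (eval_fps F x)"
proof -
  have "(\<lambda>n. fps_nth F n * x ^ n) sums eval_fps F x"
    using assms by (intro sums_eval_fps) auto
  then have "(\<lambda>n. of_real (fps_nth F n * x ^ n) :: complex) sums of_real (eval_fps F x)"
    by (rule sums_of_real)
  then show ?thesis by (simp add: eval_fps_def sums_iff)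
qed

lemma eventually_eval_fps_complex:
  assumes "fps_conv_radius F > 0"
  shows "\<forall>\<^sub>F x in nhds 0. eval_fps (fps_complex F) (of_real x) = of_real (eval_fps F x)"
proof -
  have "\<forall>\<^sub>F x in nhds (0::real). x \<in> eball 0 (fps_conv_radius F)"
    using assms by (intro eventually_nhds_in_open) (auto simp: zero_ereal_def)
  then show ?thesis
    by eventually_elim (rule eval_fps_complex, simp)
qed

text \<open>Complexified, the composite is analytic because its factors are; restriction to the real
  axis then gives the real expansion.\<close>
lemma has_fps_expansion_compose_real:
  fixes f g :: "real \<Rightarrow> real"
  assumes f: "f has_fps_expansion F" and g: "g has_fps_expansion G" and G0: "fps_nth G 0 = 0"
  shows "(\<lambda>x. f (g x)) has_fps_expansion (F oo G)"
proof -
  let ?c = "\<lambda>F. eval_fps (fps_complex F)"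
  have rF: "fps_conv_radius F > 0" and rG: "fps_conv_radius G > 0"
    using f g by (auto simp: has_fps_expansion_def)
  have "(?c F \<circ> ?c G) has_fps_expansion (fps_complex F oo fps_complex G)"
    by (intro has_fps_expansion_compose eval_fps_has_fps_expansion)
      (auto simp: fps_conv_radius_complex rF rG G0)
  then have *: "(?c F \<circ> ?c G) has_fps_expansion fps_complex (F oo G)"
    by (simp add: fps_complex_compose)
  then have rFG: "fps_conv_radius (F oo G) > 0"
    by (simp add: has_fps_expansion_def fps_conv_radius_complex)
  have lim: "filterlim complex_of_real (nhds 0) (nhds 0)"
    using tendsto_of_real[OF filterlim_ident, of 0] by simp
  \<comment> \<open>The identity holds on a complex neighbourhood of 0; continuity of the embedding
    of the reals restricts it to a real one.\<close>
  have ev1: "\<forall>\<^sub>F x in nhds 0. ?c (F oo G) (of_real x) = ?c F (?c G (of_real x))"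
    using * lim unfolding has_fps_expansion_def filterlim_iff by auto
  have evg: "\<forall>\<^sub>F x in nhds 0. eval_fps G x = g x"
    using g by (auto simp: has_fps_expansion_def)
  have g0: "g 0 = 0"
    using eventually_nhds_x_imp_x[OF evg] by (simp add: eval_fps_at_0 G0)
  have "isCont g 0"
    using has_fps_expansion_imp_continuous[OF g, of UNIV] by simp
  \<comment> \<open>Since \<open>g\<close> is continuous with \<open>g 0 = 0\<close>, whatever holds
    for \<open>y\<close> near 0 also holds for \<open>y = g x\<close> with \<open>x\<close> near
    0.\<close>
  then have limg: "filterlim g (nhds 0) (nhds 0)"
    by (simp add: isCont_def tendsto_nhds_iff g0)
  have "\<forall>\<^sub>F y in nhds 0. eval_fps F y = f y \<and> ?c F (of_real y) = of_real (eval_fps F y)"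
    using f eventually_eval_fps_complex[OF rF]
    by (auto simp: has_fps_expansion_def intro: eventually_conj)
  then have "\<forall>\<^sub>F x in nhds 0. eval_fps F (g x) = f (g x) \<and>
      ?c F (of_real (g x)) = of_real (eval_fps F (g x))"
    using limg unfolding filterlim_iff by blast
  with ev1 evg eventually_eval_fps_complex[OF rG] eventually_eval_fps_complex[OF rFG]
  have "\<forall>\<^sub>F x in nhds 0. eval_fps (F oo G) x = f (g x)"
    by eventually_elim (metis of_real_eq_iff)
  with rFG show ?thesis by (simp add: has_fps_expansion_def)
qed

section \<open>Coefficients of finite products and powers of formal power series\<close>

lemma finite_PiE_sum_eq:
  fixes n :: nat
  assumes "finite A"
  shows "finite {l \<in> A \<rightarrow>\<^sub>E UNIV. sum l A = n}"
proof (rule finite_subset)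
  show "{l \<in> A \<rightarrow>\<^sub>E UNIV. sum l A = n} \<subseteq> A \<rightarrow>\<^sub>E {..n}"
    using assms by (auto simp: PiE_iff intro: member_le_sum extensional_arb)
qed (use assms in \<open>auto intro: finite_PiE\<close>)

text \<open>Iterated Cauchy product: the induction splits off the exponent taken from the factor
  \<open>a\<close>. Parts may be zero here, and extensionality outside \<open>A\<close> makes each
  tuple of exponents occur only once.\<close>

lemma fps_prod_nth_PiE:
  fixes f :: "'b \<Rightarrow> 'a::comm_ring_1 fps"
  assumes "finite A"
  shows "fps_nth (\<Prod>i\<in>A. f i) n =
    (\<Sum>l | l \<in> A \<rightarrow>\<^sub>E UNIV \<and> sum l A = n. \<Prod>i\<in>A. fps_nth (f i) (l i))"
  using assms
proof (induction A arbitrary: n rule: finite_induct)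
  case empty
  \<comment> \<open>Over the empty index set the only extensional function is the constant
    \<open>undefined\<close>, and its sum is 0; this gives the coefficients of the empty product
    1.\<close>
  have "{l \<in> {} \<rightarrow>\<^sub>E UNIV. sum l {} = n} = (if n = 0 then {\<lambda>_. undefined} else {})"
    by auto
  then show ?case by simp
next
  case (insert a A)
  let ?S = "\<lambda>n. {l \<in> A \<rightarrow>\<^sub>E UNIV. sum l A = n}"
  have "fps_nth (\<Prod>i\<in>insert a A. f i) n =
      (\<Sum>k=0..n. fps_nth (f a) k * (\<Sum>l\<in>?S (n - k). \<Prod>i\<in>A. fps_nth (f i) (l i)))"
    using insert by (simp add: fps_mult_nth)
  also have "\<dots> = (\<Sum>(k, l)\<in>(SIGMA k:{0..n}. ?S (n - k)).
      fps_nth (f a) k * (\<Prod>i\<in>A. fps_nth (f i) (l i)))"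
    using insert by (simp add: sum_distrib_left sum.Sigma finite_PiE_sum_eq)
  also have "\<dots> = (\<Sum>l | l \<in> insert a A \<rightarrow>\<^sub>E UNIV \<and> sum l (insert a A) = n.
      \<Prod>i\<in>insert a A. fps_nth (f i) (l i))"
  \<comment> \<open>A tuple on the larger set corresponds to its value at \<open>a\<close> together
    with its restriction; resetting the value at \<open>a\<close> to \<open>undefined\<close> makes
    the restriction extensional on \<open>A\<close> again.\<close>
  proof (rule sum.reindex_bij_witness[where j = "\<lambda>(k, l). l(a := k)"
        and i = "\<lambda>l. (l a, l(a := undefined))"], goal_cases)
    case (1 x)
    then show ?case using insert.hyps by (auto simp: PiE_iff extensional_def fun_eq_iff)
  next
    case (2 x)
    have "(\<Sum>i\<in>A. if i = a then k else l i) = sum l A" for k and l :: "'b \<Rightarrow> nat"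
      using insert.hyps by (intro sum.cong) auto
    then show ?case using 2 insert.hyps by (auto simp: PiE_iff extensional_def fun_upd_def)
  next
    case (3 l)
    then show ?case by simp
  next
    case (4 l)
    have "sum (l(a := undefined)) A = sum l A"
      using insert.hyps by (intro sum.cong) auto
    then show ?case using 4 insert.hyps by (auto simp: PiE_iff extensional_def)
  next
    case (5 x)
    have "(\<Prod>i\<in>A. fps_nth (f i) (if i = a then k else l i)) = (\<Prod>i\<in>A. fps_nth (f i) (l i))"
      for k l using insert.hyps by (intro prod.cong) auto
    then show ?case using insert.hyps by (auto simp: fun_upd_def split: prod.splits)
  qed
  finally show ?case .
qed

text \<open>A vanishing constant coefficient annihilates every tuple that has a zero part, so only
  compositions into positive parts survive.\<close>

lemma fps_power_nth_compositions:
  fixes Q :: "'a::comm_ring_1 fps"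
  assumes "fps_nth Q 0 = 0"
  shows "fps_nth (Q ^ j) n = (\<Sum>l\<in>compositions j n. \<Prod>i=1..j. fps_nth Q (l i))"
proof -
  have "fps_nth (Q ^ j) n = fps_nth (\<Prod>i=1..j. Q) n" by simp
  also have "\<dots> = (\<Sum>l | l \<in> {1..j} \<rightarrow>\<^sub>E UNIV \<and> sum l {1..j} = n. \<Prod>i=1..j. fps_nth Q (l i))"
    by (rule fps_prod_nth_PiE) simp
  also have "\<dots> = (\<Sum>l\<in>compositions j n. \<Prod>i=1..j. fps_nth Q (l i))"
  proof (rule sum.mono_neutral_right)
    show "\<forall>l\<in>{l \<in> {1..j} \<rightarrow>\<^sub>E UNIV. sum l {1..j} = n} - compositions j n.
        (\<Prod>i=1..j. fps_nth Q (l i)) = 0"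
    proof
      fix l assume "l \<in> {l \<in> {1..j} \<rightarrow>\<^sub>E UNIV. sum l {1..j} = n} - compositions j n"
      then obtain i where "i \<in> {1..j}" "l i = 0"
        by (force simp: compositions_def PiE_iff)
      then show "(\<Prod>i=1..j. fps_nth Q (l i)) = 0"
        using assms by (intro prod_zero) (auto intro!: bexI[of _ i])
    qed
  qed (auto simp: compositions_def PiE_iff intro: finite_PiE_sum_eq[of "{1..j}" n, simplified])
  finally show ?thesis .
qed

section \<open>The Leibniz rule and repeated derivatives of a formal exponential\<close>

lemma sum_choose_Suc:
  fixes a b :: "nat \<Rightarrow> 'a::comm_ring_1"
  shows "(\<Sum>k\<le>Suc n. of_nat (Suc n choose k) * a k * b (Suc n - k)) =
    (\<Sum>k\<le>n. of_nat (n choose k) * a (Suc k) * b (n - k)) +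
    (\<Sum>k\<le>n. of_nat (n choose k) * a k * b (Suc (n - k)))"
proof -
  \<comment> \<open>The added term \<open>k = Suc n\<close> carries a zero binomial coefficient.
    With equal ranges on both sides, Pascal's rule finishes the proof.\<close>
  have "(\<Sum>k\<le>n. of_nat (n choose k) * a k * b (Suc (n - k))) =
      (\<Sum>k\<le>Suc n. of_nat (n choose k) * a k * b (Suc n - k))"
    by (simp add: binomial_eq_0 Suc_diff_le)
  then show ?thesis
    by (simp add: sum.atMost_Suc_shift distrib_left distrib_right sum.distrib del: sum.atMost_Suc)
qed

lemma fps_nth_deriv_mult:
  fixes F G :: "'a::comm_ring_1 fps"
  shows "fps_nth_deriv n (F * G) =
    (\<Sum>k\<le>n. of_nat (n choose k) * fps_nth_deriv k F * fps_nth_deriv (n - k) G)"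
proof (induction n arbitrary: F G)
  case (Suc n)
  show ?case
    using sum_choose_Suc[of n "\<lambda>k. fps_nth_deriv k F" "\<lambda>k. fps_nth_deriv k G"]
    by (simp add: Suc.IH add.commute del: sum.atMost_Suc)
qed simp

lemma fps_nth_deriv_nth:
  fixes F :: "real fps"
  shows "fps_nth (fps_nth_deriv n F) p = fact (n + p) / fact p * fps_nth F (n + p)"
proof (induction n arbitrary: F)
  case (Suc n)
  then show ?case by (simp add: field_simps)
qed simp

text \<open>Both sides, viewed as sequences of coefficients in \<open>n\<close>, satisfy the recursion obtained by
  differentiating the exponential; the right-hand side is the Taylor expansion of
  \<open>exp (t (F(u + s) - F(u)))\<close> in \<open>s\<close>.\<close>
lemma fps_nth_deriv_exp_ODE:
  fixes F G :: "real fps" and t :: real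
  assumes ode: "fps_deriv G = fps_const t * fps_deriv F * G"
  defines "Q \<equiv> Abs_fps (\<lambda>l. if l = 0 then 0 else fps_const (1 / fact l) * fps_nth_deriv l F)"
  shows "fps_const (1 / fact n) * fps_nth_deriv n G =
    G * (\<Sum>j\<le>n. fps_const (t ^ j / fact j) * fps_nth (Q ^ j) n)"
proof -
  \<comment> \<open>\<open>Q\<close> is a power series in a second variable s with coefficients in
    the ring of series in u, the Taylor expansion of F(u + s) - F(u). \<open>P\<close> lists the
    Taylor coefficients of G(u + s) in s, and \<open>E\<close> those of exp (t (F(u + s) -
    F(u))).\<close>
  define P where "P n = fps_const (1 / fact n) * fps_nth_deriv n G" for n
  define c where "c j = fps_const (t ^ j / fact j)" for j
  define E where "E n = (\<Sum>j\<le>n. c j * fps_nth (Q ^ j) n)" for n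
  have Q0: "fps_nth Q 0 = 0" by (simp add: Q_def)
  have recP: "of_nat (Suc n) * P (Suc n) =
      fps_const t * (\<Sum>i\<le>n. fps_nth (fps_deriv Q) i * P (n - i))" for n
  proof -
    have "of_nat (Suc n) * P (Suc n) = fps_const (1 / fact n) * fps_nth_deriv n (fps_deriv G)"
      by (simp add: P_def fps_of_nat [symmetric] del: of_nat_Suc flip: mult.assoc)
    also have "\<dots> = fps_const t * (fps_const (1 / fact n) * fps_nth_deriv n (fps_deriv F * G))"
      unfolding ode by (simp add: mult.assoc mult.left_commute)
    also have "fps_const (1 / fact n) * fps_nth_deriv n (fps_deriv F * G) =
        (\<Sum>i\<le>n. fps_nth (fps_deriv Q) i * P (n - i))"
      unfolding fps_nth_deriv_mult sum_distrib_left
    proof (rule sum.cong)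
      fix i assume "i \<in> {..n}"
      then have "real (n choose i) / fact n = 1 / (fact i * fact (n - i))"
        by (simp add: binomial_fact)
      then have coeff: "fps_const (1 / fact n) * of_nat (n choose i) =
          fps_const (1 / fact i) * fps_const (1 / fact (n - i) :: real)"
        by (simp flip: fps_of_nat)
      have "of_nat (Suc i) * fps_const (1 / fact (Suc i) :: real) = fps_const (1 / fact i)"
        by (simp del: of_nat_Suc flip: fps_of_nat)
      then have Q_deriv: "fps_nth (fps_deriv Q) i = fps_const (1 / fact i) * fps_nth_deriv i (fps_deriv F)"
        by (simp add: Q_def del: of_nat_Suc fact_Suc flip: mult.assoc)
      have "fps_const (1 / fact n) *
          (of_nat (n choose i) * fps_nth_deriv i (fps_deriv F) * fps_nth_deriv (n - i) G) =
          (fps_const (1 / fact n) * of_nat (n choose i)) *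
          (fps_nth_deriv i (fps_deriv F) * fps_nth_deriv (n - i) G)"
        by (simp only: mult.assoc)
      then show "fps_const (1 / fact n) *
          (of_nat (n choose i) * fps_nth_deriv i (fps_deriv F) * fps_nth_deriv (n - i) G) =
          fps_nth (fps_deriv Q) i * P (n - i)"
        unfolding coeff Q_deriv P_def by (simp only: mult_ac)
    qed simp
    finally show ?thesis .
  qed
  have recE: "of_nat (Suc n) * E (Suc n) =
      fps_const t * (\<Sum>i\<le>n. fps_nth (fps_deriv Q) i * E (n - i))" for n
  proof -
    \<comment> \<open>\<open>Q ^ j\<close> has no terms of order below j, so raising the summation
      bound from \<open>n - i\<close> to \<open>n\<close> adds only zeros. A bound independent of
      \<open>i\<close> permits exchanging the sums.\<close>
    have E_eq: "(\<Sum>j\<le>n. c j * fps_nth (Q ^ j) (n - i)) = E (n - i)" for i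
      unfolding E_def
      by (rule sum.mono_neutral_right) (auto simp: startsby_zero_power_prefix[OF Q0])
    have c_Suc: "c (Suc j) * of_nat (Suc j) = fps_const t * c j" for j
      by (simp add: c_def del: of_nat_Suc flip: fps_of_nat)
    have "of_nat (Suc n) * E (Suc n) = (\<Sum>j\<le>Suc n. c j * fps_nth (fps_deriv (Q ^ j)) n)"
      by (simp add: E_def sum_distrib_left mult_ac del: sum.atMost_Suc of_nat_Suc)
    \<comment> \<open>The term \<open>j = 0\<close> disappears because the derivative of
      \<open>Q ^ 0 = 1\<close> is zero.\<close>
    also have "\<dots> = (\<Sum>j\<le>n. c (Suc j) * fps_nth (fps_deriv (Q ^ Suc j)) n)"
      by (subst sum.atMost_Suc_shift) (simp del: power_Suc fps_deriv_nth)
    also have "\<dots> = (\<Sum>j\<le>n. fps_const t * (c j * fps_nth (fps_deriv Q * Q ^ j) n))"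
    proof (rule sum.cong)
      fix j
      have "fps_deriv (Q ^ Suc j) = of_nat (Suc j) * (fps_deriv Q * Q ^ j)"
        by (subst fps_deriv_power') (simp add: mult_ac)
      then have "fps_nth (fps_deriv (Q ^ Suc j)) n = of_nat (Suc j) * fps_nth (fps_deriv Q * Q ^ j) n"
        by (simp only: fps_mult_of_nat_nth)
      then show "c (Suc j) * fps_nth (fps_deriv (Q ^ Suc j)) n =
          fps_const t * (c j * fps_nth (fps_deriv Q * Q ^ j) n)"
        by (metis c_Suc mult.assoc)
    qed simp
    also have "\<dots> = fps_const t *
        (\<Sum>i\<le>n. fps_nth (fps_deriv Q) i * (\<Sum>j\<le>n. c j * fps_nth (Q ^ j) (n - i)))"
      unfolding fps_mult_nth sum_distrib_left atLeast0AtMost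
      by (subst sum.swap) (simp only: mult_ac)
    finally show ?thesis by (simp only: E_eq)
  qed
  \<comment> \<open>Both sequences start from \<open>G\<close> and obey the same recursion, which
    refers to all earlier terms; hence strong induction.\<close>
  have "P n = G * E n" for n
  proof (induction n rule: less_induct)
    case (less n)
    show ?case
    proof (cases n)
      case 0
      then show ?thesis by (simp add: P_def E_def c_def)
    next
      case (Suc k)
      have "of_nat (Suc k) * P (Suc k) =
          fps_const t * (\<Sum>i\<le>k. fps_nth (fps_deriv Q) i * (G * E (k - i)))"
        unfolding recP using less.IH Suc by simp
      also have "\<dots> = G * (of_nat (Suc k) * E (Suc k))"
        unfolding recE sum_distrib_left by (simp only: mult_ac)
      finally have "of_nat (Suc k) * P (Suc k) = of_nat (Suc k) * (G * E (Suc k))"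
        by (simp only: mult_ac)
      then show ?thesis
        unfolding Suc mult_cancel_left of_nat_eq_0_iff by simp
    qed
  qed
  then show ?thesis by (simp add: P_def E_def c_def)
qed

section \<open>Rising factorials and their generating function\<close>

lemma rising_fact_Suc: "rising_fact lam x (Suc n) = rising_fact lam x n * (x + real n * lam)"
  by (simp add: rising_fact_def)

text \<open>The last p factors of the product begin at x + l lam. These shifts, added over all parts
  of a composition of n, produce the n lam in the final formula.\<close>

lemma rising_fact_add:
  "rising_fact lam x (l + p) = rising_fact lam x l * rising_fact lam (x + real l * lam) p"
  by (induction p) (simp_all add: rising_fact_Suc rising_fact_def [of _ _ 0] algebra_simps)

lemma rising_fact_pochhammer:
  assumes "lam \<noteq> 0"
  shows "rising_fact lam x n = lam ^ n * pochhammer (x / lam) n"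
  by (induction n) (use assms in \<open>simp_all add: rising_fact_def pochhammer_Suc field_simps\<close>)

text \<open>The formal counterpart of (1 - lam s)^(-x/lam) as a series in s.\<close>

definition rising_fps :: "real \<Rightarrow> real \<Rightarrow> real fps" where
  "rising_fps lam x = Abs_fps (\<lambda>n. rising_fact lam x n / fact n)"

lemma rising_fps_nth [simp]: "fps_nth (rising_fps lam x) n = rising_fact lam x n / fact n"
  by (simp add: rising_fps_def)

text \<open>The exponent law for (1 - lam s)^(-x/lam); on coefficients it is the Vandermonde
  identity for \<open>pochhammer\<close>, rescaled by powers of \<open>lam\<close>.\<close>

lemma rising_fps_add:
  assumes "lam \<noteq> 0"
  shows "rising_fps lam (x + y) = rising_fps lam x * rising_fps lam y"
proof (rule fps_ext)
  fix n
  have "rising_fact lam (x + y) n / fact n =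
      (\<Sum>k\<le>n. lam ^ n * (real (n choose k) / fact n) * pochhammer (x / lam) k * pochhammer (y / lam) (n - k))"
    by (simp add: rising_fact_pochhammer[OF assms] add_divide_distrib pochhammer_binomial_sum
        sum_distrib_left sum_divide_distrib mult_ac)
  also have "\<dots> = (\<Sum>k\<le>n. (rising_fact lam x k / fact k) * (rising_fact lam y (n - k) / fact (n - k)))"
  proof (rule sum.cong)
    fix k assume "k \<in> {..n}"
    then have "lam ^ n = lam ^ k * lam ^ (n - k)" "real (n choose k) / fact n = 1 / (fact k * fact (n - k))"
      by (simp_all add: binomial_fact flip: power_add)
    then show "lam ^ n * (real (n choose k) / fact n) * pochhammer (x / lam) k * pochhammer (y / lam) (n - k)
        = (rising_fact lam x k / fact k) * (rising_fact lam y (n - k) / fact (n - k))"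
      by (simp add: rising_fact_pochhammer[OF assms])
  qed simp
  finally show "fps_nth (rising_fps lam (x + y)) n = fps_nth (rising_fps lam x * rising_fps lam y) n"
    by (simp add: fps_mult_nth atLeast0AtMost)
qed

lemma rising_fps_0: "rising_fps lam 0 = 1"
proof (rule fps_ext)
  fix n show "fps_nth (rising_fps lam 0) n = fps_nth 1 n"
    by (cases n) (auto simp: rising_fact_def prod.lessThan_Suc_shift simp del: prod.lessThan_Suc)
qed

lemma rising_fps_sum:
  assumes "lam \<noteq> 0" "finite A"
  shows "rising_fps lam (\<Sum>i\<in>A. x i) = (\<Prod>i\<in>A. rising_fps lam (x i))"
  using assms(2) by induction (simp_all add: rising_fps_0 rising_fps_add[OF assms(1)])

text \<open>Newton's binomial series with exponent -y/lam at the point -lam s. The sign from the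
  generalized binomial coefficient cancels the sign from the argument.\<close>

lemma deg_exp_sums:
  assumes "lam \<noteq> 0" "\<bar>lam * s\<bar> < 1"
  shows "(\<lambda>n. rising_fact lam y n / fact n * s ^ n) sums deg_exp lam y s"
proof -
  have "(\<lambda>n. (- y / lam gchoose n) * (- (lam * s)) ^ n) sums (1 + - (lam * s)) powr (- y / lam)"
    using assms by (intro gen_binomial_real) simp
  moreover have "(- y / lam gchoose n) * (- (lam * s)) ^ n = rising_fact lam y n / fact n * s ^ n" for n
  proof -
    have "(- (lam * s)) ^ n = (- 1) ^ n * lam ^ n * s ^ n"
      by (simp flip: power_mult_distrib)
    moreover have "(- 1) ^ n * (- 1) ^ n = (1 :: real)"
      by (simp flip: power_mult_distrib)
    ultimately show ?thesis
      by (simp add: gbinomial_pochhammer rising_fact_pochhammer[OF assms(1)])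
  qed
  ultimately show ?thesis
    by (simp add: deg_exp_def)
qed

section \<open>Integrability and the termwise expectation of the binomial series\<close>

lemma abs_rising_fact_le: "\<bar>rising_fact lam y n\<bar> \<le> rising_fact \<bar>lam\<bar> \<bar>y\<bar> n"
  unfolding rising_fact_def abs_prod
proof (rule prod_mono)
  fix i
  have "\<bar>y + real i * lam\<bar> \<le> \<bar>y\<bar> + \<bar>real i * lam\<bar>" by (rule abs_triangle_ineq)
  then show "0 \<le> \<bar>y + real i * lam\<bar> \<and> \<bar>y + real i * lam\<bar> \<le> \<bar>y\<bar> + real i * \<bar>lam\<bar>"
    by (simp add: abs_mult)
qed

lemma integrable_rising_fact:
  fixes Y :: "'a \<Rightarrow> real"
  assumes [measurable]: "Y \<in> borel_measurable M"
    and mom: "\<And>k::nat. integrable M (\<lambda>\<omega>. \<bar>Y \<omega>\<bar> ^ k)"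
  shows "integrable M (\<lambda>\<omega>. rising_fact lam (Y \<omega>) n)"
proof -
  \<comment> \<open>The extra power of Y strengthens the induction: the new factor Y + n lam leads
    to the exponents k + 1 and k.\<close>
  have "integrable M (\<lambda>\<omega>. Y \<omega> ^ k * rising_fact lam (Y \<omega>) n)" for k
  proof (induction n arbitrary: k)
    case 0
    have "integrable M (\<lambda>\<omega>. norm (Y \<omega> ^ k))"
      using mom[of k] by (simp add: power_abs)
    then show ?case
      by (subst (asm) integrable_norm_iff) (simp_all add: rising_fact_def)
  next
    case (Suc n)
    have "integrable M (\<lambda>\<omega>. Y \<omega> ^ Suc k * rising_fact lam (Y \<omega>) n +
        real n * lam * (Y \<omega> ^ k * rising_fact lam (Y \<omega>) n))"
      by (intro Bochner_Integration.integrable_add integrable_mult_right Suc.IH)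
    then show ?case
      by (simp add: rising_fact_Suc algebra_simps)
  qed
  from this[of 0] show ?thesis by simp
qed

text \<open>A null sequence is bounded, so the k-th term of the integrated exponential series is at
  most C (u/v)^k. Geometric convergence then allows integration term by term.\<close>

lemma integrable_exp_moment:
  fixes Y :: "'a \<Rightarrow> real"
  assumes [measurable]: "Y \<in> borel_measurable M"
    and mom: "\<And>k::nat. integrable M (\<lambda>\<omega>. \<bar>Y \<omega>\<bar> ^ k)"
    and lim: "(\<lambda>k. v ^ k * (\<integral>\<omega>. \<bar>Y \<omega>\<bar> ^ k \<partial>M) / fact k) \<longlonglongrightarrow> 0"
    and u: "0 \<le> u" "u < v"
  shows "integrable M (\<lambda>\<omega>. exp (u * \<bar>Y \<omega>\<bar>))"
proof -
  let ?m = "\<lambda>k. \<integral>\<omega>. \<bar>Y \<omega>\<bar> ^ k \<partial>M"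
  have "Bseq (\<lambda>k. v ^ k * ?m k / fact k)"
    using lim by (intro convergent_imp_Bseq) (auto simp: convergent_def)
  then obtain C where C: "\<And>k. norm (v ^ k * ?m k / fact k) \<le> C"
    by (auto simp: Bseq_def)
  have "summable (\<lambda>k. u ^ k / fact k * ?m k)"
  proof (rule summable_comparison_test)
    show "summable (\<lambda>k. C * (u / v) ^ k)"
      using u by (intro summable_mult summable_geometric) simp
    have "norm (u ^ k / fact k * ?m k) \<le> C * (u / v) ^ k" for k
    proof -
      have "norm (u ^ k / fact k * ?m k) = norm (v ^ k * ?m k / fact k) * (u / v) ^ k"
        using u by (simp add: power_divide abs_mult)
      also have "\<dots> \<le> C * (u / v) ^ k"
        using u by (intro mult_right_mono C) simp
      finally show ?thesis .
    qed
    then show "\<exists>N. \<forall>k\<ge>N. norm (u ^ k / fact k * ?m k) \<le> C * (u / v) ^ k" by blast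
  qed
  then have "integrable M (\<lambda>\<omega>. \<Sum>k. u ^ k / fact k * \<bar>Y \<omega>\<bar> ^ k)"
  proof (intro integrable_suminf)
    show "AE \<omega> in M. summable (\<lambda>k. norm (u ^ k / fact k * \<bar>Y \<omega>\<bar> ^ k))"
    proof (rule AE_I2)
      fix \<omega>
      show "summable (\<lambda>k. norm (u ^ k / fact k * \<bar>Y \<omega>\<bar> ^ k))"
        using summable_exp[of "u * \<bar>Y \<omega>\<bar>"] u
        by (simp add: abs_mult power_mult_distrib field_simps)
    qed
  qed (use mom u in \<open>simp_all add: abs_mult\<close>)
  moreover have "(\<Sum>k. u ^ k / fact k * \<bar>Y \<omega>\<bar> ^ k) = exp (u * \<bar>Y \<omega>\<bar>)" for \<omega>
    by (simp add: exp_def power_mult_distrib scaleR_conv_of_real field_simps)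
  ultimately show ?thesis by simp
qed

text \<open>Replacing \<open>lam\<close>, Y and s by their absolute values yields a nonnegative
  majorant of each term, and the majorants sum to the function in \<open>exp_mom\<close>. Its
  expectation bounds all partial sums of the integrated norms, which justifies exchanging sum and
  integral.\<close>

lemma expectation_deg_exp_sums:
  fixes Y :: "'a \<Rightarrow> real"
  assumes [measurable]: "Y \<in> borel_measurable M"
    and mom: "\<And>k::nat. integrable M (\<lambda>\<omega>. \<bar>Y \<omega>\<bar> ^ k)"
    and lam: "lam \<noteq> 0" and s: "\<bar>lam * s\<bar> < 1"
    and exp_mom: "integrable M (\<lambda>\<omega>. deg_exp \<bar>lam\<bar> \<bar>Y \<omega>\<bar> \<bar>s\<bar>)"
  shows "(\<lambda>n. (\<integral>\<omega>. rising_fact lam (Y \<omega>) n \<partial>M) / fact n * s ^ n) sums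
    (\<integral>\<omega>. deg_exp lam (Y \<omega>) s \<partial>M)"
proof -
  let ?f = "\<lambda>n \<omega>. rising_fact lam (Y \<omega>) n / fact n * s ^ n"
  let ?g = "\<lambda>n \<omega>. rising_fact \<bar>lam\<bar> \<bar>Y \<omega>\<bar> n / fact n * \<bar>s\<bar> ^ n"
  have int_f: "integrable M (?f n)" for n
    using integrable_rising_fact[OF assms(1) mom] by simp
  have int_g: "integrable M (?g n)" for n
    using integrable_rising_fact[of "\<lambda>\<omega>. \<bar>Y \<omega>\<bar>"] mom by simp
  have fg: "norm (?f n \<omega>) \<le> ?g n \<omega>" for n \<omega>
    using abs_rising_fact_le[of lam "Y \<omega>" n]
    by (simp add: abs_mult power_abs divide_right_mono mult_right_mono)
  have g_sums: "(\<lambda>n. ?g n \<omega>) sums deg_exp \<bar>lam\<bar> \<bar>Y \<omega>\<bar> \<bar>s\<bar>" for \<omega>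
    using lam s by (intro deg_exp_sums) (simp_all add: abs_mult)
  have g_nonneg: "?g n \<omega> \<ge> 0" for n \<omega>
    using order_trans[OF norm_ge_zero fg] .
  have "summable (\<lambda>n. \<integral>\<omega>. norm (?f n \<omega>) \<partial>M)"
  proof (rule bounded_imp_summable)
    fix n
    have "(\<Sum>k\<le>n. \<integral>\<omega>. norm (?f k \<omega>) \<partial>M) \<le> (\<Sum>k\<le>n. \<integral>\<omega>. ?g k \<omega> \<partial>M)"
      using int_f int_g fg by (intro sum_mono integral_mono integrable_norm) auto
    also have "\<dots> = (\<integral>\<omega>. (\<Sum>k\<le>n. ?g k \<omega>) \<partial>M)"
      using int_g by (intro Bochner_Integration.integral_sum [symmetric])
    also have "\<dots> \<le> (\<integral>\<omega>. deg_exp \<bar>lam\<bar> \<bar>Y \<omega>\<bar> \<bar>s\<bar> \<partial>M)"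
    proof (intro integral_mono exp_mom Bochner_Integration.integrable_sum int_g)
      fix \<omega>
      show "(\<Sum>k\<le>n. ?g k \<omega>) \<le> deg_exp \<bar>lam\<bar> \<bar>Y \<omega>\<bar> \<bar>s\<bar>"
        using sum_le_suminf[of "\<lambda>k. ?g k \<omega>" "{..n}"] g_sums[of \<omega>] g_nonneg
        by (simp add: sums_iff)
    qed
    finally show "(\<Sum>k\<le>n. \<integral>\<omega>. norm (?f k \<omega>) \<partial>M) \<le> (\<integral>\<omega>. deg_exp \<bar>lam\<bar> \<bar>Y \<omega>\<bar> \<bar>s\<bar> \<partial>M)" .
  qed simp
  moreover have "AE \<omega> in M. summable (\<lambda>n. norm (?f n \<omega>))"
  proof (rule AE_I2)
    fix \<omega>
    show "summable (\<lambda>n. norm (?f n \<omega>))"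
      by (rule summable_comparison_test'[where N = 0, OF sums_summable[OF g_sums[of \<omega>]]])
        (simp only: real_norm_def abs_idempotent fg[unfolded real_norm_def])
  qed
  ultimately have "(\<lambda>n. \<integral>\<omega>. ?f n \<omega> \<partial>M) sums (\<integral>\<omega>. (\<Sum>n. ?f n \<omega>) \<partial>M)"
    by (intro sums_integral int_f)
  moreover have "(\<Sum>n. ?f n \<omega>) = deg_exp lam (Y \<omega>) s" for \<omega>
    using deg_exp_sums[OF lam s] by (simp add: sums_iff)
  ultimately show ?thesis by simp
qed

definition rising_moment_fps :: "'a measure \<Rightarrow> ('a \<Rightarrow> real) \<Rightarrow> real \<Rightarrow> real fps" where
  "rising_moment_fps M Y lam = Abs_fps (\<lambda>n. (\<integral>\<omega>. rising_fact lam (Y \<omega>) n \<partial>M) / fact n)"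

lemma expectation_deg_exp_has_fps_expansion:
  fixes Y :: "'a \<Rightarrow> real"
  assumes [measurable]: "Y \<in> borel_measurable M"
    and mom: "\<And>k::nat. integrable M (\<lambda>\<omega>. \<bar>Y \<omega>\<bar> ^ k)"
    and r: "r > 0"
    and lim: "\<And>u::real. \<bar>u\<bar> < r \<Longrightarrow> (\<lambda>k. \<bar>u\<bar> ^ k * (\<integral>\<omega>. \<bar>Y \<omega>\<bar> ^ k \<partial>M) / fact k) \<longlonglongrightarrow> 0"
    and lam: "lam \<noteq> 0"
  shows "(\<lambda>s. \<integral>\<omega>. deg_exp lam (Y \<omega>) s \<partial>M) has_fps_expansion rising_moment_fps M Y lam"
proof -
  let ?F = "rising_moment_fps M Y lam"
  \<comment> \<open>Chosen so that the majorant
    \<open>deg_exp \<bar>lam\<bar> y \<bar>s\<bar>\<close> equals \<open>exp (h s * y)\<close>. As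
    \<open>h\<close> tends to 0 at 0, the exponential moment is available once
    \<open>h s < r / 2\<close>, with r/2 as a point inside the range of the moment
    condition.\<close>
  define h where "h s = - ln (1 - \<bar>lam\<bar> * \<bar>s\<bar>) / \<bar>lam\<bar>" for s
  have "isCont h 0"
    unfolding h_def using lam by (intro continuous_intros) auto
  then have "(h \<longlongrightarrow> 0) (nhds 0)"
    by (simp add: isCont_def tendsto_nhds_iff h_def)
  then have "\<forall>\<^sub>F s in nhds 0. h s < r / 2"
    using r by (intro order_tendstoD) auto
  moreover have "((\<lambda>s. \<bar>lam * s\<bar>) \<longlongrightarrow> \<bar>lam * 0\<bar>) (nhds 0)"
    by (intro tendsto_intros filterlim_ident)
  then have "\<forall>\<^sub>F s in nhds 0. \<bar>lam * s\<bar> < 1"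
    by (intro order_tendstoD) auto
  ultimately have "\<forall>\<^sub>F s in nhds 0. (\<lambda>n. fps_nth ?F n * s ^ n) sums (\<integral>\<omega>. deg_exp lam (Y \<omega>) s \<partial>M)"
  proof eventually_elim
    case (elim s)
    then have pos: "1 - \<bar>lam\<bar> * \<bar>s\<bar> > 0" by (simp add: abs_mult)
    then have "0 \<le> h s"
      by (auto simp: h_def divide_nonpos_nonneg)
    then have "integrable M (\<lambda>\<omega>. exp (h s * \<bar>Y \<omega>\<bar>))"
      using elim r lim[of "r / 2"] by (intro integrable_exp_moment[of Y M "r / 2"] mom) auto
    moreover have "deg_exp \<bar>lam\<bar> y \<bar>s\<bar> = exp (h s * y)" for y
      using pos by (simp add: deg_exp_def powr_def h_def)
    ultimately show ?case
      using expectation_deg_exp_sums[OF assms(1) mom lam elim(2)]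
      by (simp add: rising_moment_fps_def)
  qed
  note sums = this
  then obtain d where d: "d > 0"
    "\<And>s. \<bar>s\<bar> < d \<Longrightarrow> (\<lambda>n. fps_nth ?F n * s ^ n) sums (\<integral>\<omega>. deg_exp lam (Y \<omega>) s \<partial>M)"
    by (auto simp: eventually_nhds_metric dist_real_def)
  \<comment> \<open>Convergence at the single point d/2 already bounds the radius from
    below.\<close>
  have "norm (d / 2) \<le> fps_conv_radius ?F"
    unfolding fps_conv_radius_def using d(2)[of "d / 2"] d(1)
    by (intro conv_radius_geI) (auto simp: sums_iff)
  moreover have "0 < ereal (norm (d / 2))" using d(1) by simp
  ultimately have "0 < fps_conv_radius ?F" by (rule less_le_trans [rotated])
  moreover have "\<forall>\<^sub>F s in nhds 0. eval_fps ?F s = (\<integral>\<omega>. deg_exp lam (Y \<omega>) s \<partial>M)"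
    using sums by eventually_elim (simp add: eval_fps_def sums_iff)
  ultimately show ?thesis by (simp add: has_fps_expansion_def)
qed

section \<open>Products of derivatives of the moment series as expectations\<close>

lemma borel_measurable_rising_fact [measurable]:
  "(\<lambda>x. rising_fact lam x n) \<in> borel_measurable borel"
  unfolding rising_fact_def by measurable

text \<open>A coefficient of the product is a sum over exponent tuples q of products of moments of
  order \<open>l i + q i\<close>. Independence merges each product into one expectation, and inside
  it the sum over q collapses by multiplicativity of \<open>rising_fps\<close>.\<close>

lemma (in prob_space) expectation_rising_fact_prod:
  fixes Y :: "'a \<Rightarrow> real" and X :: "nat \<Rightarrow> 'a \<Rightarrow> real" and l :: "nat \<Rightarrow> nat"
  assumes Y[measurable]: "Y \<in> borel_measurable M"
    and mom: "\<And>k::nat. integrable M (\<lambda>\<omega>. \<bar>Y \<omega>\<bar> ^ k)"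
    and "finite A"
    and ind: "indep_vars (\<lambda>_. borel) X A"
    and eqd: "\<And>i. i \<in> A \<Longrightarrow> distr M borel (X i) = distr M borel Y"
    and lam: "lam \<noteq> 0"
  shows "expectation (\<lambda>\<omega>. rising_fact lam ((\<Sum>i\<in>A. X i \<omega>) + real (\<Sum>i\<in>A. l i) * lam) p *
      (\<Prod>i\<in>A. rising_fact lam (X i \<omega>) (l i))) =
    fact p * fps_nth (\<Prod>i\<in>A. fps_nth_deriv (l i) (rising_moment_fps M Y lam)) p"
proof -
  let ?S = "{q \<in> A \<rightarrow>\<^sub>E UNIV. sum q A = p}"
  let ?f = "\<lambda>q i \<omega>. rising_fact lam (X i \<omega>) (l i + q i) / fact (q i)"
  have X[measurable]: "X i \<in> borel_measurable M" if "i \<in> A" for i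
    using ind that by (auto simp: indep_vars_def)
  have int: "integrable M (\<lambda>\<omega>. rising_fact lam (X i \<omega>) k)"
    and eq: "expectation (\<lambda>\<omega>. rising_fact lam (X i \<omega>) k) =
      expectation (\<lambda>\<omega>. rising_fact lam (Y \<omega>) k)" if "i \<in> A" for i k
  proof -
    have "integrable (distr M borel (X i)) (\<lambda>x. rising_fact lam x k)"
      unfolding eqd[OF that]
      using integrable_rising_fact[OF Y mom] by (subst integrable_distr_eq) auto
    then show "integrable M (\<lambda>\<omega>. rising_fact lam (X i \<omega>) k)"
      using X[OF that] by (subst (asm) integrable_distr_eq) auto
    show "expectation (\<lambda>\<omega>. rising_fact lam (X i \<omega>) k) = expectation (\<lambda>\<omega>. rising_fact lam (Y \<omega>) k)"
      using integral_distr[of "X i" M borel "\<lambda>x. rising_fact lam x k"] X[OF that]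
        integral_distr[of Y M borel "\<lambda>x. rising_fact lam x k"] Y eqd[OF that] by simp
  qed
  have indf: "indep_vars (\<lambda>_. borel) (?f q) A" for q
    by (rule indep_vars_compose2[OF ind]) simp
  have intf: "integrable M (?f q i)" if "i \<in> A" for q i
    using int[OF that] by simp
  have "fps_nth (\<Prod>i\<in>A. fps_nth_deriv (l i) (rising_moment_fps M Y lam)) p =
      (\<Sum>q\<in>?S. \<Prod>i\<in>A. expectation (?f q i))"
    by (simp add: fps_prod_nth_PiE[OF \<open>finite A\<close>] fps_nth_deriv_nth rising_moment_fps_def eq
        cong: prod.cong)
  also have "\<dots> = (\<Sum>q\<in>?S. expectation (\<lambda>\<omega>. \<Prod>i\<in>A. ?f q i \<omega>))"
    by (intro sum.cong refl indep_vars_lebesgue_integral[symmetric] \<open>finite A\<close> indf intf)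
  also have "\<dots> = expectation (\<lambda>\<omega>. \<Sum>q\<in>?S. \<Prod>i\<in>A. ?f q i \<omega>)"
    by (intro Bochner_Integration.integral_sum[symmetric] indep_vars_integrable \<open>finite A\<close> indf intf)
  also have "(\<lambda>\<omega>. \<Sum>q\<in>?S. \<Prod>i\<in>A. ?f q i \<omega>) =
      (\<lambda>\<omega>. rising_fact lam ((\<Sum>i\<in>A. X i \<omega>) + real (\<Sum>i\<in>A. l i) * lam) p *
        (\<Prod>i\<in>A. rising_fact lam (X i \<omega>) (l i)) / fact p)"
  proof
    fix \<omega>
    \<comment> \<open>Splitting each rising factorial at \<open>l i\<close> leaves a factor free of
      q; the rest is a coefficient of a product of shifted series, whose arguments add up.\<close>
    have "(\<Sum>q\<in>?S. \<Prod>i\<in>A. ?f q i \<omega>) = (\<Prod>i\<in>A. rising_fact lam (X i \<omega>) (l i)) *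
        fps_nth (\<Prod>i\<in>A. rising_fps lam (X i \<omega> + real (l i) * lam)) p"
      by (simp add: fps_prod_nth_PiE[OF \<open>finite A\<close>] rising_fact_add sum_distrib_left
          flip: prod.distrib)
    also have "(\<Prod>i\<in>A. rising_fps lam (X i \<omega> + real (l i) * lam)) =
        rising_fps lam ((\<Sum>i\<in>A. X i \<omega>) + real (\<Sum>i\<in>A. l i) * lam)"
      by (simp add: rising_fps_sum[OF lam \<open>finite A\<close>, symmetric] sum.distrib sum_distrib_right)
    finally show "(\<Sum>q\<in>?S. \<Prod>i\<in>A. ?f q i \<omega>) =
        rising_fact lam ((\<Sum>i\<in>A. X i \<omega>) + real (\<Sum>i\<in>A. l i) * lam) p *
        (\<Prod>i\<in>A. rising_fact lam (X i \<omega>) (l i)) / fact p"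
      by simp
  qed
  finally show ?thesis by simp
qed

section \<open>Faa di Bruno's formula over compositions and comparison of coefficients\<close>

lemma fps_nth_deriv_exp_compositions:
  fixes F G :: "real fps" and t :: real
  assumes "fps_deriv G = fps_const t * fps_deriv F * G"
  shows "fps_nth_deriv n G = (\<Sum>j\<le>n. \<Sum>l\<in>compositions j n.
    fps_const (t ^ j / fact j * multinomial n j l) * (\<Prod>i=1..j. fps_nth_deriv (l i) F) * G)"
proof -
  define Q where "Q = Abs_fps (\<lambda>l. if l = 0 then 0 else fps_const (1 / fact l) * fps_nth_deriv l F)"
  \<comment> \<open>Positive parts never reach the zero branch in the definition of
    \<open>Q\<close>.\<close>
  have l_pos: "l i > 0" if "l \<in> compositions j n" "i \<in> {1..j}" for l i j
    using PiE_mem[of l "{1..j}" "\<lambda>_. {1..}" i] that by (auto simp: compositions_def)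
  have Qj: "fps_nth (Q ^ j) n = (\<Sum>l\<in>compositions j n.
      fps_const (1 / (\<Prod>i=1..j. fact (l i))) * (\<Prod>i=1..j. fps_nth_deriv (l i) F))" for j
  proof -
    have "fps_nth (Q ^ j) n = (\<Sum>l\<in>compositions j n. \<Prod>i=1..j. fps_nth Q (l i))"
      by (rule fps_power_nth_compositions) (simp add: Q_def)
    also have "\<dots> = (\<Sum>l\<in>compositions j n.
        \<Prod>i=1..j. fps_const (1 / fact (l i)) * fps_nth_deriv (l i) F)"
      by (intro sum.cong prod.cong refl) (use l_pos in \<open>fastforce simp: Q_def\<close>)
    also have "(\<Prod>i=1..j. fps_const (1 / fact (l i)) :: real fps) =
        fps_const (1 / (\<Prod>i=1..j. fact (l i)))" for l :: "nat \<Rightarrow> nat"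
      by (induction j) simp_all
    then have "(\<Sum>l\<in>compositions j n.
        \<Prod>i=1..j. fps_const (1 / fact (l i)) * fps_nth_deriv (l i) F) =
        (\<Sum>l\<in>compositions j n.
        fps_const (1 / (\<Prod>i=1..j. fact (l i))) * (\<Prod>i=1..j. fps_nth_deriv (l i) F))"
      by (simp only: prod.distrib)
    finally show ?thesis .
  qed
  \<comment> \<open>Undoing the Taylor normalization contributes n!, which joins the reciprocals of
    the \<open>fact (l i)\<close> from \<open>Q\<close> to form the multinomial coefficient.\<close>
  have "fps_nth_deriv n G = fps_const (fact n) * (fps_const (1 / fact n) * fps_nth_deriv n G)"
    by (simp flip: mult.assoc)
  also have "\<dots> = fps_const (fact n) *
      (G * (\<Sum>j\<le>n. fps_const (t ^ j / fact j) * fps_nth (Q ^ j) n))"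
    by (simp only: fps_nth_deriv_exp_ODE[OF assms, of n] Q_def)
  also have "\<dots> = (\<Sum>j\<le>n. \<Sum>l\<in>compositions j n. (fps_const (fact n) * fps_const (t ^ j / fact j) *
      fps_const (1 / (\<Prod>i=1..j. fact (l i)))) * (\<Prod>i=1..j. fps_nth_deriv (l i) F) * G)"
    by (simp only: Qj sum_distrib_left mult_ac)
  also have "\<dots> = (\<Sum>j\<le>n. \<Sum>l\<in>compositions j n.
    fps_const (t ^ j / fact j * multinomial n j l) * (\<Prod>i=1..j. fps_nth_deriv (l i) F) * G)"
    by (simp add: multinomial_def mult_ac)
  finally show ?thesis .
qed

theorem theorem2p8:
  fixes M :: "'a measure" and Y :: "'a \<Rightarrow> real" and X :: "nat \<Rightarrow> 'a \<Rightarrow> real"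
    and lam r t :: real and m n :: nat
  assumes "prob_space M"
    and "Y \<in> borel_measurable M"
    and "\<And>k::nat. integrable M (\<lambda>\<omega>. \<bar>Y \<omega>\<bar> ^ k)"
    and "r > 0"
    and "\<And>u::real. \<bar>u\<bar> < r \<Longrightarrow>
           (\<lambda>k. \<bar>u\<bar> ^ k * prob_space.expectation M (\<lambda>\<omega>. \<bar>Y \<omega>\<bar> ^ k) / fact k) \<longlonglongrightarrow> 0"
    and "prob_space.indep_vars M (\<lambda>_. borel) X {1..}"
    and "\<And>i. i \<ge> 1 \<Longrightarrow> distr M borel (X i) = distr M borel Y"
    and "lam \<noteq> 0"
  shows "hbell M Y lam (n + m) t =
    (\<Sum>j=0..n. \<Sum>k=0..m. real (m choose k) * (t ^ j / fact j) *
       (\<Sum>l\<in>compositions j n. multinomial n j l *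
          prob_space.expectation M (\<lambda>\<omega>.
            rising_fact lam ((\<Sum>i=1..j. X i \<omega>) + real n * lam) (m - k) *
            (\<Prod>i=1..j. rising_fact lam (X i \<omega>) (l i)))) *
       hbell M Y lam k t)"
proof -
  interpret prob_space M by fact
  define F where "F = rising_moment_fps M Y lam"
  define G where "G = fps_exp t oo (F - 1)"
  \<comment> \<open>The moment of order 0 is the total mass 1, so substituting \<open>F - 1\<close>
    into the exponential series is legitimate.\<close>
  have F0: "fps_nth (F - 1) 0 = 0"
    by (simp add: F_def rising_moment_fps_def rising_fact_def prob_space)
  have ode: "fps_deriv G = fps_const t * fps_deriv F * G"
    unfolding G_def fps_compose_deriv[OF F0]
    by (simp add: fps_compose_mult_distrib[OF F0])
  have "(\<lambda>s. (\<integral>\<omega>. deg_exp lam (Y \<omega>) s \<partial>M) - 1) has_fps_expansion F - 1"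
    unfolding F_def using assms
    by (intro has_fps_expansion_diff expectation_deg_exp_has_fps_expansion[of Y M r]) auto
  then have G: "hbell_gf M Y lam t has_fps_expansion G"
    unfolding hbell_gf_def G_def
    by (intro has_fps_expansion_compose_real[OF has_fps_expansion_exp] F0)
  then have "(THE F. hbell_gf M Y lam t has_fps_expansion F) = G"
    by (intro the_equality has_fps_expansion_unique)
  then have hbell: "hbell M Y lam k t = fact k * fps_nth G k" for k
    by (simp add: hbell_def)
  define e where "e j l p = expectation (\<lambda>\<omega>. rising_fact lam ((\<Sum>i=1..j. X i \<omega>) + real n * lam) p *
      (\<Prod>i=1..j. rising_fact lam (X i \<omega>) (l i)))" for j l p
  \<comment> \<open>The parts of a composition sum to n, so the accumulated shift is n lam whatever
    \<open>l\<close> is.\<close>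
  have e: "fact p * fps_nth (\<Prod>i=1..j. fps_nth_deriv (l i) F) p = e j l p"
    if "l \<in> compositions j n" for j l p
  proof -
    have "indep_vars (\<lambda>_. borel) X {1..j}"
      using assms(6) by (rule indep_vars_subset) auto
    moreover have "(\<Sum>i=1..j. l i) = n" using that by (simp add: compositions_def)
    ultimately show ?thesis
      using expectation_rising_fact_prod[of Y "{1..j}" X lam l p] assms
      by (simp add: e_def F_def)
  qed
  \<comment> \<open>Multiplying a Cauchy product by m! turns it into a binomial convolution of the
    factorially scaled coefficients; those of \<open>G\<close> are the Bell polynomials.\<close>
  have conv: "fact m * fps_nth (fps_const c * H * G) m =
      (\<Sum>k=0..m. real (m choose k) * (c * (fact (m - k) * fps_nth H (m - k))) * hbell M Y lam k t)"
    for c and H :: "real fps"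
  proof -
    have "fps_nth (fps_const c * H * G) m = (\<Sum>k=0..m. fps_nth G k * (c * fps_nth H (m - k)))"
      by (subst mult.commute[of _ G]) (simp add: fps_mult_nth[of G])
    also have "fact m * \<dots> =
      (\<Sum>k=0..m. real (m choose k) * (c * (fact (m - k) * fps_nth H (m - k))) * hbell M Y lam k t)"
      unfolding sum_distrib_left
    proof (rule sum.cong)
      fix k assume "k \<in> {0..m}"
      then have "(fact m :: real) = real (m choose k) * fact (m - k) * fact k"
        by (simp add: binomial_fact)
      then show "fact m * (fps_nth G k * (c * fps_nth H (m - k))) =
          real (m choose k) * (c * (fact (m - k) * fps_nth H (m - k))) * hbell M Y lam k t"
        by (simp add: hbell)
    qed simp
    finally show ?thesis .
  qed
  have "hbell M Y lam (n + m) t = fact m * fps_nth (fps_nth_deriv n G) m"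
    by (simp add: hbell fps_nth_deriv_nth)
  also have "\<dots> = (\<Sum>j\<le>n. \<Sum>l\<in>compositions j n. fact m *
      fps_nth (fps_const (t ^ j / fact j * multinomial n j l) *
        (\<Prod>i=1..j. fps_nth_deriv (l i) F) * G) m)"
    by (simp only: fps_nth_deriv_exp_compositions[OF ode] fps_sum_nth sum_distrib_left)
  also have "\<dots> = (\<Sum>j\<le>n. \<Sum>l\<in>compositions j n. \<Sum>k=0..m.
      real (m choose k) * (t ^ j / fact j * multinomial n j l * e j l (m - k)) * hbell M Y lam k t)"
    by (intro sum.cong refl) (simp only: conv e)
  also have "\<dots> = (\<Sum>j\<le>n. \<Sum>k=0..m. \<Sum>l\<in>compositions j n.
      real (m choose k) * (t ^ j / fact j * multinomial n j l * e j l (m - k)) * hbell M Y lam k t)"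
    by (intro sum.cong refl sum.swap)
  also have "\<dots> = (\<Sum>j=0..n. \<Sum>k=0..m. real (m choose k) * (t ^ j / fact j) *
      (\<Sum>l\<in>compositions j n. multinomial n j l * e j l (m - k)) * hbell M Y lam k t)"
    unfolding atLeast0AtMost sum_distrib_left sum_distrib_right by (simp only: mult_ac)
  finally show ?thesis
    unfolding e_def .
qed

end
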